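(* For $n\ge1$ let $S_n(132)$ be the set of $132$-avoiding permutations of $\{1,\dots,n\}$, and for $\sigma=\sigma_1\cdots\sigma_n$ let $\mathrm{box}(\sigma)$ be the number of indices $i$ such that $|\sigma_i-\sigma_{i+1}|=1$ or $|\sigma_{i-1}-\sigma_i|=1$ (ignoring nonexistent entries). Let $A_0(x)=1$, $A_n(x)=\sum_{\sigma\in S_n(132)}x^{\mathrm{box}(\sigma)}$, $B_n(x)=\sum_{\sigma\in S_n(132),\sigma_1=n}x^{\mathrm{box}(\sigma)}$, $E_n(x)=\sum_{\sigma\in S_n(132),\sigma_n=n}x^{\mathrm{box}(\sigma)}$. Then for $n\le3$, $A_n(x)|_{x^4}=B_n(x)|_{x^4}=E_n(x)|_{x^4}=0$; $B_4(x)|_{x^4}=2$; $B_5(x)|_{x^4}=6$; for $n\ge4$, $$A_n(x)|_{x^4}=2B_n(x)|_{x^4}+B_{n-1}(x)|_{x^4}+\sum_{i=2}^{n-2}F_{i-2}F_{n-i};$$ and for $n\ge6$, $$B_n(x)|_{x^4}=B_{n-1}(x)|_{x^4}+B_{n-2}(x)|_{x^4}+F_{n-1}+\sum_{i=4}^{n-3}F_{i-2}F_{n-1-i}.$$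
   Context: A permutation $\sigma\in S_n$ avoids $132$ if there are no indices $i<j<k$ with $\sigma_i<\sigma_k<\sigma_j$. $P(x)|_{x^m}$ denotes the coefficient of $x^m$ in the polynomial $P(x)$. The Fibonacci numbers are defined by $F_0=F_1=1$ and $F_n=F_{n-1}+F_{n-2}$ for $n\ge2$. Empty sums are $0$. *)

theory Defs
  imports
    "HOL-Computational_Algebra.Polynomial"
    "HOL-Combinatorics.Permutations"
    "HOL-Number_Theory.Fib"
begin

definition avoids_132 :: "nat \<Rightarrow> (nat \<Rightarrow> nat) \<Rightarrow> bool" where
  "avoids_132 n \<sigma> \<longleftrightarrow>
     \<not> (\<exists>i j k. 1 \<le> i \<and> i < j \<and> j < k \<and> k \<le> n \<and> \<sigma> i < \<sigma> k \<and> \<sigma> k < \<sigma> j)"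

definition S132 :: "nat \<Rightarrow> (nat \<Rightarrow> nat) set" where
  "S132 n = {\<sigma>. \<sigma> permutes {1..n} \<and> avoids_132 n \<sigma>}"

(* The values of a permutation outside {1..n} are junk (fixed points), hence the
   guards i < n and 1 < i. *)
definition box :: "nat \<Rightarrow> (nat \<Rightarrow> nat) \<Rightarrow> nat" where
  "box n \<sigma> = card {i \<in> {1..n}.
     (i < n \<and> \<bar>int (\<sigma> i) - int (\<sigma> (i + 1))\<bar> = 1) \<or>
     (1 < i \<and> \<bar>int (\<sigma> (i - 1)) - int (\<sigma> i)\<bar> = 1)}"

definition A_poly :: "nat \<Rightarrow> nat poly" where
  "A_poly n = (\<Sum>\<sigma>\<in>S132 n. monom 1 (box n \<sigma>))"

(* At n = 0 the formulas below give 0 for B_poly and 1 for E_poly; neither value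
   has a term in positive degree. *)
definition B_poly :: "nat \<Rightarrow> nat poly" where
  "B_poly n = (\<Sum>\<sigma>\<in>{\<sigma> \<in> S132 n. \<sigma> 1 = n}. monom 1 (box n \<sigma>))"

definition E_poly :: "nat \<Rightarrow> nat poly" where
  "E_poly n = (\<Sum>\<sigma>\<in>{\<sigma> \<in> S132 n. \<sigma> n = n}. monom 1 (box n \<sigma>))"

(* Fibonacci numbers normalised by F 0 = F 1 = 1, whereas fib 0 = 0. *)
definition F :: "nat \<Rightarrow> nat" where
  "F n = fib (n + 1)"

lemma F_rec: "F 0 = 1" "F 1 = 1" "n \<ge> 2 \<Longrightarrow> F n = F (n - 1) + F (n - 2)"
proof -
  show "F 0 = 1" "F 1 = 1" by (simp_all add: F_def)
  assume "n \<ge> 2"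
  then obtain k where "n = Suc (Suc k)" by (metis Suc_le_D numeral_2_eq_2 Suc_le_mono)
  then show "F n = F (n - 1) + F (n - 2)" by (simp add: F_def)
qed

lemma finite_S132: "finite (S132 n)"
  unfolding S132_def by (rule finite_subset[OF _ finite_permutations[of "{1..n}"]]) auto

lemma A_poly_0: "A_poly 0 = 1"
proof -
  have "S132 0 = {id}" by (auto simp: S132_def avoids_132_def)
  then show ?thesis by (simp add: A_poly_def box_def monom_0 one_pCons)
qed

end

theory Submission
  imports Defs
begin

text \<open>
  Write a \<open>132\<close>-avoider as \<open>L n R\<close> with \<open>n\<close> its maximum: every entry of \<open>L\<close> exceeds every entry
  of \<open>R\<close>, so for nonempty \<open>L\<close> no adjacency links \<open>n\<close> to \<open>R\<close> and the box count is additive over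
  \<open>L n\<close> and \<open>R\<close>.  Hence \<open>A n = B n + (\<Sum>i=2..n. E i * A (n - i))\<close>.  Prepending a new maximum to the
  set of all avoiders, or appending it, changes the box count by \<open>0\<close>, \<open>1\<close> or \<open>2\<close> according to how
  many of the largest values already stand at that end, and the resulting recurrences determine
  \<open>B\<close> and \<open>E\<close> from \<open>A\<close>; they are the same for both ends, so \<open>B = E\<close>.  Comparing coefficients up to
  degree \<open>4\<close> then gives the result, the Fibonacci numbers being the coefficients of \<open>x\<^sup>2\<close>.
\<close>

subsection \<open>Avoidance and the box statistic on lists\<close>

text \<open>\<open>sorted_wrt\<close> tests every ordered pair of positions, not only neighbours, so
  the clause says that the head never plays the 1 of a pattern 132.\<close>

fun avoids_list :: "nat list \<Rightarrow> bool" where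
  "avoids_list [] \<longleftrightarrow> True"
| "avoids_list (x # xs) \<longleftrightarrow> sorted_wrt (\<lambda>y z. \<not> (x < z \<and> z < y)) xs \<and> avoids_list xs"

lemma avoids_list_iff_nth:
  "avoids_list xs \<longleftrightarrow>
     (\<forall>i j k. i < j \<longrightarrow> j < k \<longrightarrow> k < length xs \<longrightarrow> \<not> (xs ! i < xs ! k \<and> xs ! k < xs ! j))"
proof (induction xs)
  case (Cons x xs)
  let ?Q = "\<lambda>ys i j k. \<not> (ys ! i < ys ! k \<and> ys ! k < (ys :: nat list) ! j)"
  show ?case (is "_ \<longleftrightarrow> ?R")
  proof
    assume l: "avoids_list (x # xs)"
    show ?R
    proof (intro allI impI)
      fix i j k assume ijk: "i < j" "j < k" "k < length (x # xs)"
      then obtain j' k' where jk: "j = Suc j'" "k = Suc k'"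
        by (metis less_nat_zero_code not0_implies_Suc)
      show "?Q (x # xs) i j k"
      proof (cases i)
        case 0
        then show ?thesis using l ijk jk by (auto simp: sorted_wrt_iff_nth_less)
      next
        case (Suc i')
        then show ?thesis using l ijk jk Cons.IH by auto
      qed
    qed
  next
    assume r: ?R
    have "?Q xs i j k" if "i < j" "j < k" "k < length xs" for i j k
      using r[rule_format, of "Suc i" "Suc j" "Suc k"] that by simp
    moreover have "\<not> (x < xs ! k \<and> xs ! k < xs ! j)" if "j < k" "k < length xs" for j k
      using r[rule_format, of 0 "Suc j" "Suc k"] that by simp
    ultimately show "avoids_list (x # xs)"
      using Cons.IH by (auto simp: sorted_wrt_iff_nth_less)
  qed
qed simp

lemma sorted_wrt_if_all: "(\<And>y z. y \<in> set xs \<Longrightarrow> z \<in> set xs \<Longrightarrow> P y z) \<Longrightarrow> sorted_wrt P xs"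
  by (induction xs) auto

text \<open>An occurrence using \<open>n\<close> has it as the 3, and any occurrence reaching from
  \<open>L\<close> into \<open>R\<close> has its 1 in \<open>L\<close> and its 2 in
  \<open>R\<close>; the last conjunct rules out exactly these. It is weak since entries may repeat
  here.\<close>

lemma avoids_list_append_max:
  assumes "\<And>x. x \<in> set L \<union> set R \<Longrightarrow> x < n"
  shows "avoids_list (L @ n # R) \<longleftrightarrow>
    avoids_list L \<and> avoids_list R \<and> (\<forall>x\<in>set L. \<forall>y\<in>set R. y \<le> x)"
  using assms
proof (induction L)
  case Nil
  have "sorted_wrt (\<lambda>y z. \<not> (n < z \<and> z < y)) R"
    using Nil by (intro sorted_wrt_if_all) force
  then show ?case by simp
next
  case (Cons x L)
  have IH: "avoids_list (L @ n # R) \<longleftrightarrow>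
    avoids_list L \<and> avoids_list R \<and> (\<forall>x\<in>set L. \<forall>y\<in>set R. y \<le> x)"
    using Cons by auto
  have "sorted_wrt (\<lambda>y z. \<not> (x < z \<and> z < y)) (L @ n # R) \<longleftrightarrow>
     sorted_wrt (\<lambda>y z. \<not> (x < z \<and> z < y)) L \<and> (\<forall>y\<in>set R. y \<le> x)" (is "?l \<longleftrightarrow> ?r")
  proof
    assume ?l
    then show ?r using Cons.prems by (force simp: sorted_wrt_append)
  next
    assume r: ?r
    then have "sorted_wrt (\<lambda>y z. \<not> (x < z \<and> z < y)) R"
      by (intro sorted_wrt_if_all) force
    then show ?l using r Cons.prems by (force simp: sorted_wrt_append)
  qed
  then show ?case using IH by auto
qed

lemma avoids_list_map_add [simp]: "avoids_list (map (\<lambda>x. x + m) xs) \<longleftrightarrow> avoids_list xs"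
  by (induction xs) (auto simp: sorted_wrt_map)

definition adj :: "nat \<Rightarrow> nat \<Rightarrow> bool" where
  "adj x y \<longleftrightarrow> x = Suc y \<or> y = Suc x"

text \<open>The flag records whether the head is adjacent in value to an entry preceding the list.\<close>

fun boxl :: "bool \<Rightarrow> nat list \<Rightarrow> nat" where
  "boxl b [] = 0"
| "boxl b [x] = of_bool b"
| "boxl b (x # y # zs) = of_bool (b \<or> adj x y) + boxl (adj x y) (y # zs)"

definition near :: "nat list \<Rightarrow> nat \<Rightarrow> bool" where
  "near xs i \<longleftrightarrow> (Suc i < length xs \<and> adj (xs ! i) (xs ! Suc i)) \<or>
     (0 < i \<and> adj (xs ! (i - 1)) (xs ! i))"

lemma boxl_eq_sum: "boxl b xs = (\<Sum>i<length xs. of_bool (i = 0 \<and> b \<or> near xs i))"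
proof (induction b xs rule: boxl.induct)
  case (3 b x y zs)
  have near_0: "near (x # y # zs) 0 \<longleftrightarrow> adj x y" by (simp add: near_def)
  have near_Suc: "near (x # y # zs) (Suc i) \<longleftrightarrow> i = 0 \<and> adj x y \<or> near (y # zs) i" for i
    by (cases i) (auto simp: near_def)
  have "(\<Sum>i<length (x # y # zs). of_bool (i = 0 \<and> b \<or> near (x # y # zs) i) :: nat) =
    of_bool (b \<or> near (x # y # zs) 0) + (\<Sum>i<length (y # zs). of_bool (near (x # y # zs) (Suc i)))"
    by (simp only: length_Cons sum.lessThan_Suc_shift) simp
  then show ?case unfolding near_0 near_Suc boxl.simps 3 by simp
qed (auto simp: near_def)

lemma boxl_False_eq_sum: "boxl False xs = (\<Sum>i<length xs. of_bool (near xs i))"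
  by (simp add: boxl_eq_sum)

lemma adj_commute: "adj x y \<longleftrightarrow> adj y x"
  by (auto simp: adj_def)

lemma near_rev:
  assumes "i < length xs"
  shows "near (rev xs) i \<longleftrightarrow> near xs (length xs - Suc i)"
  using assms by (auto simp: near_def rev_nth adj_commute Suc_diff_Suc)

text \<open>Reversal keeps neighbours neighbours. This turns appending a maximum into prepending
  one.\<close>

lemma boxl_rev: "boxl False (rev xs) = boxl False xs"
proof -
  have "boxl False (rev xs) = (\<Sum>i<length xs. of_bool (near xs (length xs - Suc i)))"
    unfolding boxl_False_eq_sum by (intro sum.cong) (auto simp: near_rev)
  also have "\<dots> = boxl False xs"
    unfolding boxl_False_eq_sum by (rule sum.nat_diff_reindex)
  finally show ?thesis .
qed

text \<open>The flag handed on to \<open>ys\<close> records the adjacency at the junction, hence is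
  \<open>False\<close>; an empty \<open>xs\<close> would pass on \<open>b\<close> instead.\<close>

lemma boxl_append:
  assumes "ys \<noteq> [] \<Longrightarrow> \<not> adj (last xs) (hd ys)" "xs \<noteq> []"
  shows "boxl b (xs @ ys) = boxl b xs + boxl False ys"
  using assms
proof (induction b xs rule: boxl.induct)
  case (2 b x)
  then show ?case by (cases ys) auto
qed auto

lemma boxl_map_add [simp]: "boxl b (map (\<lambda>x. x + m) xs) = boxl b xs"
  by (induction b xs rule: boxl.induct) (auto simp: adj_def)

lemma boxl_Cons_not_adj:
  "(ys \<noteq> [] \<Longrightarrow> \<not> adj x (hd ys)) \<Longrightarrow> boxl False (x # ys) = boxl False ys"
  by (cases ys) auto

text \<open>The new entry \<open>x\<close> always counts; \<open>y\<close> is newly counted unless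
  its right neighbour already made it count.\<close>

lemma boxl_Cons_Cons_adj:
  assumes "adj x y"
  shows "boxl False (x # y # zs) =
    (if zs \<noteq> [] \<and> adj y (hd zs) then 1 else 2) + boxl False (y # zs)"
  using assms by (cases zs) auto

subsection \<open>Decomposition at the maximum\<close>

definition avoiders :: "nat \<Rightarrow> nat list set" where
  "avoiders n = {xs. distinct xs \<and> set xs = {1..n} \<and> avoids_list xs}"

lemma length_avoiders: "xs \<in> avoiders n \<Longrightarrow> length xs = n"
  by (auto simp: avoiders_def dest: distinct_card)

lemma finite_avoiders: "finite (avoiders n)"
proof (rule finite_subset)
  show "avoiders n \<subseteq> {xs. set xs \<subseteq> {1..n} \<and> length xs = n}"
    using length_avoiders by (auto simp: avoiders_def)
qed (simp add: finite_lists_length_eq)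

lemma avoiders_0 [simp]: "avoiders 0 = {[]}"
  by (auto simp: avoiders_def)

text \<open>Applied to the entries left (\<open>A\<close>) and right (\<open>B\<close>) of the
  maximum: their sizes alone determine which values they hold.\<close>

lemma lower_part_of_interval:
  fixes A B :: "nat set"
  assumes un: "A \<union> B = {1..n}" and less: "\<And>a b. a \<in> A \<Longrightarrow> b \<in> B \<Longrightarrow> b < a"
  shows "B = {1..card B}" "A = {card B + 1..n}"
proof -
  have fin: "finite B" by (rule finite_subset[of _ "{1..n}"]) (use un in auto)
  have "\<exists>k. B = {1..k}"
  proof (cases "B = {}")
    case False
    have "B = {1..Max B}"
    proof (intro set_eqI iffI)
      fix x assume "x \<in> B"
      then show "x \<in> {1..Max B}" using fin un by auto
    next
      fix x assume x: "x \<in> {1..Max B}"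
      have "Max B \<in> B" using fin False by simp
      with x un have "x \<in> A \<union> B" by (metis UnI2 atLeastAtMost_iff le_trans)
      with \<open>Max B \<in> B\<close> x less show "x \<in> B" by fastforce
    qed
    then show ?thesis by blast
  qed (auto intro: exI[of _ 0])
  then obtain k where k: "B = {1..k}" by blast
  then show B: "B = {1..card B}" by simp
  show "A = {card B + 1..n}"
  proof (intro set_eqI iffI)
    fix x assume x: "x \<in> A"
    then have "x \<notin> B" using less by blast
    then show "x \<in> {card B + 1..n}" using x un k by auto
  next
    fix x assume "x \<in> {card B + 1..n}"
    then show "x \<in> A" using un k by auto
  qed
qed

text \<open>With the maximum at position \<open>j\<close>, the \<open>m\<close> entries after it are
  the smallest values, so the left part is an avoider of length \<open>j\<close> shifted by
  \<open>m\<close>.\<close>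

lemma avoiders_split:
  "bij_betw (\<lambda>(L, R). map (\<lambda>x. x + m) L @ Suc (m + j) # R) (avoiders j \<times> avoiders m)
     {xs \<in> avoiders (Suc (m + j)). xs ! j = Suc (m + j)}"
  (is "bij_betw ?f ?D ?T")
proof (rule bij_betw_imageI)
  show "inj_on ?f ?D"
  proof (rule inj_onI, clarify)
    fix L R L' R' assume L: "L \<in> avoiders j" "L' \<in> avoiders j"
      and eq: "map (\<lambda>x. x + m) L @ Suc (m + j) # R = map (\<lambda>x. x + m) L' @ Suc (m + j) # R'"
    then have "map (\<lambda>x. x + m) L = map (\<lambda>x. x + m) L'" "R = R'"
      using length_avoiders[OF L(1)] length_avoiders[OF L(2)]
      by auto
    moreover have "inj (\<lambda>x::nat. x + m)" by (simp add: inj_def)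
    ultimately show "L = L' \<and> R = R'" by simp
  qed
  show "?f ` ?D = ?T"
  proof (intro set_eqI iffI)
    fix xs assume "xs \<in> ?f ` ?D"
    then obtain L R where L: "L \<in> avoiders j" and R: "R \<in> avoiders m"
      and xs: "xs = map (\<lambda>x. x + m) L @ Suc (m + j) # R" by auto
    let ?L = "map (\<lambda>x. x + m) L"
    have sL: "set ?L = {m + 1..m + j}"
      using L by (simp add: avoiders_def add.commute)
    have sR: "set R = {1..m}" using R by (simp add: avoiders_def)
    have "avoids_list xs" unfolding xs
      by (subst avoids_list_append_max) (use L R sL sR in \<open>auto simp: avoiders_def\<close>)
    moreover have "distinct xs"
      using L R sL sR unfolding xs by (auto simp: avoiders_def distinct_map)
    moreover have "set xs = {1..Suc (m + j)}"
      using sL sR unfolding xs by auto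
    moreover have "xs ! j = Suc (m + j)"
      unfolding xs using length_avoiders[OF L] by (simp add: nth_append)
    ultimately show "xs \<in> ?T" by (simp add: avoiders_def)
  next
    fix xs assume xs: "xs \<in> ?T"
    define L R where "L = take j xs" and "R = drop (Suc j) xs"
    have len: "length xs = Suc (m + j)" using xs length_avoiders by blast
    have split: "xs = L @ Suc (m + j) # R"
      unfolding L_def R_def using id_take_nth_drop[of j xs] xs len by simp
    have d: "distinct (L @ Suc (m + j) # R)" and s: "set (L @ Suc (m + j) # R) = {1..Suc (m + j)}"
      and a: "avoids_list (L @ Suc (m + j) # R)"
      using xs unfolding split by (auto simp: avoiders_def)
    have "set L \<union> set R = set (L @ Suc (m + j) # R) - {Suc (m + j)}" using d by auto
    also have "\<dots> = {1..m + j}" unfolding s by auto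
    finally have un: "set L \<union> set R = {1..m + j}" .
    have lt: "x < Suc (m + j)" if "x \<in> set L \<union> set R" for x
      using that unfolding un by auto
    have av: "avoids_list L \<and> avoids_list R \<and> (\<forall>x\<in>set L. \<forall>y\<in>set R. y \<le> x)"
      using a avoids_list_append_max[of L R "Suc (m + j)", OF lt] by blast
    have less: "y < x" if "x \<in> set L" "y \<in> set R" for x y
    proof -
      have "y \<noteq> x" using d that by auto
      then show ?thesis using av that by (meson le_neq_implies_less)
    qed
    have cR: "card (set R) = m" using d len by (simp add: distinct_card R_def)
    have sR: "set R = {1..m}" and sL: "set L = {m + 1..m + j}"
      using lower_part_of_interval[OF un less] unfolding cR by blast+
    \<comment> \<open>Truncated subtraction is undone by adding \<open>m\<close>, as all entries of
      \<open>L\<close> exceed \<open>m\<close>.\<close>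
    define L' where "L' = map (\<lambda>x. x - m) L"
    have L: "L = map (\<lambda>x. x + m) L'"
      unfolding L'_def map_map by (rule map_idI[symmetric]) (use sL in auto)
    have "(\<lambda>x. x + m) ` set L' = (\<lambda>x. x + m) ` {1..j}" using sL L by (simp add: add.commute)
    then have "set L' = {1..j}" by (subst (asm) inj_image_eq_iff) (auto simp: inj_def)
    moreover have "distinct L'" "avoids_list L'"
      using d av unfolding L by (auto simp: distinct_map)
    ultimately have "L' \<in> avoiders j" by (simp add: avoiders_def)
    moreover have "R \<in> avoiders m" using d av sR by (simp add: avoiders_def)
    ultimately show "xs \<in> ?f ` ?D" using split L by force
  qed
qed

lemma avoiders_nth_0_max: "{xs \<in> avoiders (Suc n). xs ! 0 = Suc n} = (#) (Suc n) ` avoiders n"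
proof -
  have "{xs \<in> avoiders (Suc n). xs ! 0 = Suc n} =
      (\<lambda>(L, R). map (\<lambda>x. x + n) L @ Suc n # R) ` ({[]} \<times> avoiders n)"
    using bij_betw_imp_surj_on[OF avoiders_split[of n 0]] by simp
  also have "{[]} \<times> avoiders n = Pair [] ` avoiders n"
    by blast
  finally show ?thesis by (simp add: image_image)
qed

lemma avoiders_hd_max: "{xs \<in> avoiders (Suc n). hd xs = Suc n} = (#) (Suc n) ` avoiders n"
proof -
  have "hd xs = xs ! 0" if "xs \<in> avoiders (Suc n)" for xs
    using length_avoiders[OF that] by (cases xs) auto
  then have "{xs \<in> avoiders (Suc n). hd xs = Suc n} = {xs \<in> avoiders (Suc n). xs ! 0 = Suc n}"
    by auto
  then show ?thesis by (simp only: avoiders_nth_0_max)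
qed

lemma avoiders_last_max:
  "{xs \<in> avoiders (Suc n). last xs = Suc n} = (\<lambda>xs. xs @ [Suc n]) ` avoiders n"
proof -
  have "last xs = xs ! n" if "xs \<in> avoiders (Suc n)" for xs
    using length_avoiders[OF that] by (cases xs) (auto simp: last_conv_nth)
  then have "{xs \<in> avoiders (Suc n). last xs = Suc n} = {xs \<in> avoiders (Suc n). xs ! n = Suc n}"
    by auto
  also have "\<dots> = (\<lambda>(L, R). L @ Suc n # R) ` (avoiders n \<times> {[]})"
    using bij_betw_imp_surj_on[OF avoiders_split[of 0 n]] by simp
  also have "avoiders n \<times> {[]} = (\<lambda>L. (L, [])) ` avoiders n"
    by blast
  finally show ?thesis by (simp add: image_image)
qed

subsection \<open>Recurrences for the generating polynomials\<close>

definition gf :: "nat list set \<Rightarrow> nat poly" where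
  "gf S = (\<Sum>xs\<in>S. monom 1 (boxl False xs))"

lemma gf_rev: "gf (rev ` S) = gf S"
  unfolding gf_def by (subst sum.reindex) (auto simp: boxl_rev)

text \<open>\<open>A n\<close> is the generating polynomial of a family of lists of length \<open>n\<close> and \<open>H n\<close> that of its
  members of length \<open>n + 1\<close> starting with their maximum; \<open>G n\<close> is the part of \<open>H n\<close> where the
  second largest value comes next, \<open>U n\<close> the rest.\<close>

definition end_recurrence :: "(nat \<Rightarrow> nat poly) \<Rightarrow> (nat \<Rightarrow> nat poly) \<Rightarrow> (nat \<Rightarrow> nat poly) \<Rightarrow>
    (nat \<Rightarrow> nat poly) \<Rightarrow> bool" where
  "end_recurrence A H U G \<longleftrightarrow> U 0 = 1 \<and> G 0 = 0 \<and>
     (\<forall>n. H n = U n + G n) \<and> (\<forall>n. U (Suc n) + H n = A (Suc n)) \<and>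
     (\<forall>n. G (Suc n) = monom 1 2 * U n + monom 1 1 * G n)"

text \<open>Over \<open>nat\<close> there is no subtraction: \<open>U (Suc n)\<close> is recovered
  from \<open>A (Suc n)\<close> by cancelling \<open>H n\<close>, which the induction hypothesis for
  \<open>U\<close> and \<open>G\<close> fixes.\<close>

lemma end_recurrence_unique:
  assumes "end_recurrence A H U G" "end_recurrence A H' U' G'"
  shows "H n = H' n"
proof -
  have "U n = U' n \<and> G n = G' n"
    using assms by (induction n) (auto simp: end_recurrence_def, metis add_right_cancel)
  then show ?thesis using assms by (simp add: end_recurrence_def)
qed

text \<open>Stated for a general family \<open>V\<close> so that it covers both the avoiders and
  their reversals, which avoid 231 instead.\<close>

lemma end_recurrence_Cons:
  assumes fin: "\<And>n. finite (V n)" and sub: "\<And>n xs. xs \<in> V n \<Longrightarrow> set xs \<subseteq> {1..n}"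
    and V0: "V 0 = {[]}"
    and VSuc: "\<And>n. {xs \<in> V (Suc n). hd xs = Suc n} = (#) (Suc n) ` V n"
  shows "\<exists>U G. end_recurrence (\<lambda>n. gf (V n)) (\<lambda>n. gf ((#) (Suc n) ` V n)) U G"
proof -
  \<comment> \<open>\<open>hd []\<close> is unspecified, so the guard is what places the empty list
    in \<open>U 0\<close> rather than \<open>G 0\<close>.\<close>
  define P where "P n xs \<longleftrightarrow> xs \<noteq> [] \<and> hd xs = n" for n :: nat and xs :: "nat list"
  define w where "w n xs = (monom 1 (boxl False (Suc n # xs)) :: nat poly)" for n xs
  define U where "U n = (\<Sum>xs\<in>{xs \<in> V n. \<not> P n xs}. w n xs)" for n
  define G where "G n = (\<Sum>xs\<in>{xs \<in> V n. P n xs}. w n xs)" for n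
  have not_adj: "\<not> adj (Suc n) (hd xs)" if "xs \<in> V n" "\<not> P n xs" "xs \<noteq> []" for n xs
  proof -
    have "hd xs \<in> {1..n}" using sub that by (meson hd_in_set subsetD)
    then show ?thesis using that by (auto simp: P_def adj_def)
  qed
  have split: "(\<Sum>xs\<in>V n. f xs) = (\<Sum>xs\<in>{xs \<in> V n. \<not> P n xs}. f xs) + (\<Sum>xs\<in>{xs \<in> V n. P n xs}. f xs)"
    for n and f :: "nat list \<Rightarrow> nat poly"
    by (subst sum.union_disjoint[symmetric]) (auto simp: fin intro!: sum.cong)
  have H: "gf ((#) (Suc n) ` V n) = (\<Sum>xs\<in>V n. w n xs)" for n
    unfolding gf_def w_def by (subst sum.reindex) auto
  have HUG: "gf ((#) (Suc n) ` V n) = U n + G n" for n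
    unfolding H U_def G_def by (rule split)
  have P_Suc: "{xs \<in> V (Suc n). P (Suc n) xs} = (#) (Suc n) ` V n" for n
    using VSuc[of n] by (auto simp: P_def)
  \<comment> \<open>Prepending a maximum to a list in \<open>V (Suc n)\<close> that does not start
    with \<open>Suc n\<close> creates no adjacency and keeps its weight; the other lists are those
    counted by \<open>H n\<close>.\<close>
  have UA: "U (Suc n) + gf ((#) (Suc n) ` V n) = gf (V (Suc n))" for n
  proof -
    have "U (Suc n) = gf {xs \<in> V (Suc n). \<not> P (Suc n) xs}"
      unfolding U_def gf_def w_def
      by (intro sum.cong refl arg_cong[of _ _ "monom 1"] boxl_Cons_not_adj) (use not_adj in auto)
    then show ?thesis
      unfolding gf_def split[of _ "Suc n"] P_Suc by simp
  qed
  \<comment> \<open>Relative to \<open>Suc n # xs\<close>, a further maximum adds 1 if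
    \<open>xs\<close> starts with \<open>n\<close>, since \<open>Suc n\<close> then counts already,
    and 2 otherwise.\<close>
  have G_Suc: "G (Suc n) = monom 1 2 * U n + monom 1 1 * G n" for n
  proof -
    have "G (Suc n) = (\<Sum>xs\<in>V n. monom 1 (boxl False (Suc (Suc n) # Suc n # xs)))"
      unfolding G_def P_Suc w_def by (subst sum.reindex) auto
    also have "\<dots> = (\<Sum>xs\<in>V n. monom 1 (if P n xs then 1 else 2) * w n xs)"
    proof (intro sum.cong refl)
      fix xs assume xs: "xs \<in> V n"
      have "xs \<noteq> [] \<and> adj (Suc n) (hd xs) \<longleftrightarrow> P n xs"
        using not_adj[OF xs] by (auto simp: P_def adj_def)
      then show "monom 1 (boxl False (Suc (Suc n) # Suc n # xs)) =
          monom 1 (if P n xs then 1 else 2) * w n xs"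
        unfolding w_def by (subst boxl_Cons_Cons_adj) (auto simp: adj_def mult_monom)
    qed
    also have "\<dots> = monom 1 2 * U n + monom 1 1 * G n"
      unfolding split U_def G_def sum_distrib_left by (intro arg_cong2[of _ _ _ _ "(+)"] sum.cong) auto
    finally show ?thesis .
  qed
  have empty: "{xs \<in> V 0. \<not> P 0 xs} = {[]}" "{xs \<in> V 0. P 0 xs} = {}"
    by (auto simp: V0 P_def)
  have "U 0 = 1"
    by (simp add: U_def w_def empty monom_0 one_pCons)
  moreover have "G 0 = 0"
    by (simp add: G_def empty)
  ultimately show ?thesis
    unfolding end_recurrence_def using HUG UA G_Suc by blast
qed

lemma end_recurrence_avoiders:
  "\<exists>U G. end_recurrence (\<lambda>n. gf (avoiders n)) (\<lambda>n. gf ((#) (Suc n) ` avoiders n)) U G"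
  by (rule end_recurrence_Cons) (auto simp: finite_avoiders avoiders_hd_max, auto simp: avoiders_def)

text \<open>Since \<open>gf\<close> is invariant under \<open>rev\<close>, both ends satisfy the
  same recurrence over the same \<open>A\<close>, and uniqueness gives equality without a
  bijection.\<close>

lemma gf_last_max: "gf ((\<lambda>xs. xs @ [Suc n]) ` avoiders n) = gf ((#) (Suc n) ` avoiders n)"
proof -
  have "\<exists>U G. end_recurrence (\<lambda>n. gf (rev ` avoiders n)) (\<lambda>n. gf ((#) (Suc n) ` rev ` avoiders n)) U G"
  proof (rule end_recurrence_Cons)
    fix n
    have "{xs \<in> rev ` avoiders (Suc n). hd xs = Suc n} = rev ` {xs \<in> avoiders (Suc n). last xs = Suc n}"
      by (auto simp: hd_rev)
    also have "\<dots> = (#) (Suc n) ` rev ` avoiders n"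
      unfolding avoiders_last_max by (simp add: image_image)
    finally show "{xs \<in> rev ` avoiders (Suc n). hd xs = Suc n} = (#) (Suc n) ` rev ` avoiders n" .
  qed (auto simp: finite_avoiders, auto simp: avoiders_def)
  moreover have "(#) (Suc n) ` rev ` avoiders n = rev ` (\<lambda>xs. xs @ [Suc n]) ` avoiders n" for n
    by (simp add: image_image)
  ultimately have 2: "\<exists>U G. end_recurrence (\<lambda>n. gf (avoiders n))
      (\<lambda>n. gf ((\<lambda>xs. xs @ [Suc n]) ` avoiders n)) U G"
    by (simp add: gf_rev)
  show ?thesis using end_recurrence_avoiders 2 end_recurrence_unique by blast
qed

text \<open>For \<open>j > 0\<close> the maximum exceeds every entry to its right by at least 2, so
  the weight factors; \<open>gf_last_max\<close> then rewrites the left factor.\<close>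

lemma gf_split:
  assumes "j > 0"
  shows "gf {xs \<in> avoiders (Suc (m + j)). xs ! j = Suc (m + j)} =
    gf ((#) (Suc j) ` avoiders j) * gf (avoiders m)"
proof -
  have "gf {xs \<in> avoiders (Suc (m + j)). xs ! j = Suc (m + j)} =
      (\<Sum>(L, R)\<in>avoiders j \<times> avoiders m.
        monom 1 (boxl False (map (\<lambda>x. x + m) L @ Suc (m + j) # R)))"
    unfolding gf_def
    by (subst sum.reindex_bij_betw[OF avoiders_split, symmetric]) (simp add: case_prod_unfold)
  also have "\<dots> = (\<Sum>(L, R)\<in>avoiders j \<times> avoiders m.
        monom 1 (boxl False (L @ [Suc j])) * monom 1 (boxl False R))"
  proof (intro sum.cong refl, clarify)
    fix L R assume "L \<in> avoiders j" and R: "R \<in> avoiders m"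
    \<comment> \<open>The maximum joins the shifted block: it is \<open>Suc j\<close>, the maximum
      put after \<open>L\<close>, moved up by \<open>m\<close>.\<close>
    have *: "map (\<lambda>x. x + m) L @ Suc (m + j) # R = map (\<lambda>x. x + m) (L @ [Suc j]) @ R"
      by simp
    have "\<not> adj (Suc (m + j)) (hd R)" if "R \<noteq> []"
    proof -
      have "hd R \<in> {1..m}" using R that by (metis (mono_tags, lifting) avoiders_def hd_in_set mem_Collect_eq)
      then show ?thesis using assms by (auto simp: adj_def)
    qed
    then show "monom 1 (boxl False (map (\<lambda>x. x + m) L @ Suc (m + j) # R)) =
        monom 1 (boxl False (L @ [Suc j])) * (monom 1 (boxl False R) :: nat poly)"
      unfolding * by (subst boxl_append) (auto simp: mult_monom add.commute last_map simp del: map_append)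
  qed
  also have "\<dots> = (\<Sum>L\<in>avoiders j. monom 1 (boxl False (L @ [Suc j]))) * gf (avoiders m)"
    unfolding gf_def sum_product sum.cartesian_product ..
  also have "(\<Sum>L\<in>avoiders j. monom 1 (boxl False (L @ [Suc j]))) = gf ((\<lambda>xs. xs @ [Suc j]) ` avoiders j)"
    unfolding gf_def by (subst sum.reindex) (auto simp: inj_on_def)
  finally show ?thesis by (simp add: gf_last_max)
qed

text \<open>Sum over the position \<open>j\<close> of the maximum. Position 0 stands apart, as there
  the maximum may be adjacent to its successor.\<close>

lemma gf_avoiders_Suc:
  "gf (avoiders (Suc n)) = gf ((#) (Suc n) ` avoiders n) +
     (\<Sum>j=1..n. gf ((#) (Suc j) ` avoiders j) * gf (avoiders (n - j)))"
proof -
  let ?T = "\<lambda>j. {xs \<in> avoiders (Suc n). xs ! j = Suc n}"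
  have un: "avoiders (Suc n) = (\<Union>j\<in>{..n}. ?T j)"
  proof -
    have "\<exists>j\<le>n. xs ! j = Suc n" if "xs \<in> avoiders (Suc n)" for xs
    proof -
      have "Suc n \<in> set xs" using that by (auto simp: avoiders_def)
      then show ?thesis using length_avoiders[OF that] by (auto simp: in_set_conv_nth less_Suc_eq_le)
    qed
    then show ?thesis by auto
  qed
  have "gf (avoiders (Suc n)) = (\<Sum>j\<le>n. gf (?T j))"
    unfolding gf_def
  proof (subst un, rule sum.UNION_disjoint)
    show "\<forall>i\<in>{..n}. \<forall>j\<in>{..n}. i \<noteq> j \<longrightarrow> ?T i \<inter> ?T j = {}"
      using length_avoiders by (auto simp: avoiders_def) (metis le_imp_less_Suc nth_eq_iff_index_eq)
  qed (auto simp: finite_avoiders)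
  also have "{..n} = insert 0 {1..n}" by auto
  also have "(\<Sum>j\<in>\<dots>. gf (?T j)) = gf (?T 0) + (\<Sum>j=1..n. gf (?T j))" by simp
  also have "?T 0 = (#) (Suc n) ` avoiders n"
    by (rule avoiders_nth_0_max)
  also have "(\<Sum>j=1..n. gf (?T j)) = (\<Sum>j=1..n. gf ((#) (Suc j) ` avoiders j) * gf (avoiders (n - j)))"
  proof (intro sum.cong refl)
    fix j assume "j \<in> {1..n}"
    then show "gf (?T j) = gf ((#) (Suc j) ` avoiders j) * gf (avoiders (n - j))"
      using gf_split[of j "n - j"] by simp
  qed
  finally show ?thesis .
qed

subsection \<open>From permutations to lists\<close>

lemma bij_betw_S132_avoiders: "bij_betw (\<lambda>\<sigma>. map \<sigma> [1..<Suc n]) (S132 n) (avoiders n)"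
proof (rule bij_betw_imageI)
  have av: "avoids_132 n \<sigma> \<longleftrightarrow> avoids_list (map \<sigma> [1..<Suc n])" for \<sigma>
  proof
    assume a: "avoids_132 n \<sigma>"
    show "avoids_list (map \<sigma> [1..<Suc n])"
      unfolding avoids_list_iff_nth
    proof (intro allI impI)
      fix i j k assume "i < j" "j < k" "k < length (map \<sigma> [1..<Suc n])"
      moreover from this have "\<not> (\<sigma> (Suc i) < \<sigma> (Suc k) \<and> \<sigma> (Suc k) < \<sigma> (Suc j))"
        using a unfolding avoids_132_def
        by (metis One_nat_def Suc_leI Suc_less_eq diff_Suc_1 le_add1 length_map length_upt plus_1_eq_Suc)
      ultimately show "\<not> (map \<sigma> [1..<Suc n] ! i < map \<sigma> [1..<Suc n] ! k \<and>
          map \<sigma> [1..<Suc n] ! k < map \<sigma> [1..<Suc n] ! j)"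
        by (simp del: upt_Suc)
    qed
  next
    assume a: "avoids_list (map \<sigma> [1..<Suc n])"
    show "avoids_132 n \<sigma>"
      unfolding avoids_132_def
    proof clarify
      fix i j k assume "1 \<le> i" "i < j" "j < k" "k \<le> n" "\<sigma> i < \<sigma> k" "\<sigma> k < \<sigma> j"
      moreover from this have "i - 1 < j - 1" "j - 1 < k - 1" "k - 1 < n" by auto
      ultimately show False
        using a[unfolded avoids_list_iff_nth, rule_format, of "i - 1" "j - 1" "k - 1"]
        by (simp del: upt_Suc)
    qed
  qed
  show "inj_on (\<lambda>\<sigma>. map \<sigma> [1..<Suc n]) (S132 n)"
  proof (rule inj_onI)
    fix \<sigma> \<tau> assume st: "\<sigma> \<in> S132 n" "\<tau> \<in> S132 n" and eq: "map \<sigma> [1..<Suc n] = map \<tau> [1..<Suc n]"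
    show "\<sigma> = \<tau>"
    proof
      fix x
      show "\<sigma> x = \<tau> x"
      proof (cases "x \<in> {1..n}")
        case True
        then show ?thesis using eq by (auto simp del: upt_Suc simp: less_Suc_eq_le)
      next
        case False
        then show ?thesis using st by (auto simp: S132_def permutes_not_in)
      qed
    qed
  qed
  show "(\<lambda>\<sigma>. map \<sigma> [1..<Suc n]) ` S132 n = avoiders n"
  proof (intro set_eqI iffI)
    fix xs assume "xs \<in> (\<lambda>\<sigma>. map \<sigma> [1..<Suc n]) ` S132 n"
    then obtain \<sigma> where s: "\<sigma> permutes {1..n}" "avoids_132 n \<sigma>" and xs: "xs = map \<sigma> [1..<Suc n]"
      by (auto simp: S132_def)
    have "set [1..<Suc n] = {1..n}" by auto
    then show "xs \<in> avoiders n"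
      unfolding avoiders_def xs using s av permutes_image[OF s(1)] permutes_inj_on[OF s(1)]
      by (simp del: upt_Suc add: distinct_map)
  next
    fix xs assume xs: "xs \<in> avoiders n"
    note len = length_avoiders[OF xs]
    \<comment> \<open>\<open>permutes\<close> forces the identity outside \<open>{1..n}\<close>;
      list positions start at 0, hence \<open>i - 1\<close>.\<close>
    define \<sigma> where "\<sigma> i = (if i \<in> {1..n} then xs ! (i - 1) else i)" for i
    have map: "map \<sigma> [1..<Suc n] = xs"
      by (rule nth_equalityI) (auto simp: len \<sigma>_def simp del: upt_Suc)
    have "set [1..<Suc n] = {1..n}" by auto
    then have "inj_on \<sigma> {1..n}" "\<sigma> ` {1..n} = {1..n}"
      using xs unfolding avoiders_def map[symmetric] by (auto simp: distinct_map simp del: upt_Suc)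
    then have "\<sigma> permutes {1..n}"
      by (intro bij_imp_permutes) (auto simp: bij_betw_def \<sigma>_def)
    moreover have "avoids_132 n \<sigma>" using xs av map by (simp add: avoiders_def)
    ultimately show "xs \<in> (\<lambda>\<sigma>. map \<sigma> [1..<Suc n]) ` S132 n"
      using map by (force simp: S132_def)
  qed
qed

lemma boxl_map_upt: "boxl False (map \<sigma> [1..<Suc n]) = box n \<sigma>"
proof -
  let ?P = "\<lambda>i. (i < n \<and> \<bar>int (\<sigma> i) - int (\<sigma> (i + 1))\<bar> = 1) \<or>
     (1 < i \<and> \<bar>int (\<sigma> (i - 1)) - int (\<sigma> i)\<bar> = 1)"
  have adj: "adj x y \<longleftrightarrow> \<bar>int x - int y\<bar> = 1" for x y by (auto simp: adj_def)
  have "boxl False (map \<sigma> [1..<Suc n]) = (\<Sum>i<n. of_bool (?P (Suc i)))"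
    unfolding boxl_False_eq_sum
    by (intro sum.cong) (auto simp: near_def adj simp del: upt_Suc)
  also have "\<dots> = (\<Sum>i\<in>{1..n}. of_bool (?P i))"
    by (rule sum.reindex_bij_witness[of _ "\<lambda>i. i - 1" Suc]) auto
  also have "\<dots> = box n \<sigma>"
    unfolding box_def by (subst sum_of_bool_eq) (auto intro!: arg_cong[of _ _ card])
  finally show ?thesis .
qed

lemma A_poly_eq_gf: "A_poly n = gf (avoiders n)"
  unfolding A_poly_def gf_def
  by (subst sum.reindex_bij_betw[OF bij_betw_S132_avoiders, symmetric]) (simp only: boxl_map_upt)

lemma B_poly_Suc_eq_gf: "B_poly (Suc n) = gf ((#) (Suc n) ` avoiders n)"
proof -
  define g where "g \<sigma> = map \<sigma> [1..<Suc (Suc n)]" for \<sigma> :: "nat \<Rightarrow> nat"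
  have hd: "hd (g \<sigma>) = \<sigma> 1" for \<sigma> by (simp add: g_def upt_rec)
  have bij: "bij_betw g (S132 (Suc n)) (avoiders (Suc n))"
    using bij_betw_S132_avoiders[of "Suc n"] by (simp add: g_def[abs_def] del: upt_Suc)
  have box: "box (Suc n) \<sigma> = boxl False (g \<sigma>)" for \<sigma>
    unfolding g_def by (rule boxl_map_upt[symmetric])
  have "{xs \<in> avoiders (Suc n). hd xs = Suc n} = g ` {\<sigma> \<in> S132 (Suc n). \<sigma> 1 = Suc n}"
    unfolding bij_betw_imp_surj_on[OF bij, symmetric] by (auto simp: hd)
  moreover have "inj_on g {\<sigma> \<in> S132 (Suc n). \<sigma> 1 = Suc n}"
    by (rule inj_on_subset[OF bij_betw_imp_inj_on[OF bij]]) auto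
  ultimately have "gf {xs \<in> avoiders (Suc n). hd xs = Suc n} = B_poly (Suc n)"
    unfolding B_poly_def gf_def box by (simp add: sum.reindex)
  then show ?thesis by (simp add: avoiders_hd_max)
qed

subsection \<open>Low-degree coefficients\<close>

text \<open>\<open>H n\<close> stands for \<open>B_poly (Suc n)\<close>, so indices of
  \<open>H\<close> lag by one. \<open>U_Suc\<close> is the decomposition at the maximum after
  cancelling \<open>H n\<close>.\<close>

locale box_recurrence =
  fixes A H U G :: "nat \<Rightarrow> nat poly"
  assumes A0: "A 0 = 1" and U0: "U 0 = 1" and G0: "G 0 = 0"
    and HUG: "\<And>n. H n = U n + G n"
    and A_Suc: "\<And>n. A (Suc n) = H n + U (Suc n)"
    and U_Suc: "\<And>n. U (Suc n) = (\<Sum>j=1..n. H j * A (n - j))"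
    and G_Suc: "\<And>n. G (Suc n) = monom 1 2 * U n + monom 1 1 * G n"
begin

lemma coeff_G_Suc:
  "coeff (G (Suc n)) k =
     (if k < 2 then 0 else coeff (U n) (k - 2)) + (if k < 1 then 0 else coeff (G n) (k - 1))"
  by (simp add: G_Suc coeff_monom_mult)

lemma H0: "H 0 = 1" by (simp add: HUG U0 G0)

lemma coeff_U_Suc: "coeff (U (Suc n)) k = (\<Sum>j=1..n. \<Sum>i\<le>k. coeff (H j) i * coeff (A (n - j)) (k - i))"
  by (simp add: U_Suc coeff_sum coeff_mult)

lemma G_coeff_0: "coeff (G n) 0 = 0"
  by (cases n) (simp_all add: G0 coeff_G_Suc)

lemma G_coeff_1: "coeff (G n) 1 = 0"
  using G_coeff_0 by (cases n) (simp_all add: G0 coeff_G_Suc)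

text \<open>Every factor \<open>H j\<close> in the convolution has \<open>1 \<le> j\<close>, so by
  induction it lacks a constant term.\<close>

lemma U_coeff_0: "coeff (U n) 0 = of_bool (n = 0)"
proof (induction n rule: less_induct)
  case (less n)
  show ?case
    using less by (cases n) (auto simp: U0 coeff_U_Suc HUG G_coeff_0)
qed

lemma H_coeff_0: "coeff (H n) 0 = of_bool (n = 0)"
  by (simp add: HUG G_coeff_0 U_coeff_0)

lemma A_coeff_0: "coeff (A n) 0 = of_bool (n \<le> 1)"
  by (cases n) (auto simp: A0 A_Suc H_coeff_0 U_coeff_0)

lemma U_coeff_1: "coeff (U n) 1 = 0"
proof (induction n rule: less_induct)
  case (less n)
  show ?case
    using less G_coeff_1 by (cases n) (auto simp: U0 coeff_U_Suc HUG H_coeff_0 G_coeff_0 U_coeff_0)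
qed

lemma H_coeff_1: "coeff (H n) 1 = 0"
  using U_coeff_1 G_coeff_1 by (simp add: HUG)

lemma A_coeff_1: "coeff (A n) 1 = 0"
  using H_coeff_1 U_coeff_1 by (cases n) (auto simp: A0 A_Suc)

lemma G_coeff_2: "coeff (G n) 2 = of_bool (n = 1)"
  using U_coeff_0 G_coeff_1 by (cases n) (auto simp: G0 coeff_G_Suc)

lemma G_coeff_3: "coeff (G n) 3 = of_bool (n = 2)"
  using U_coeff_1 G_coeff_2 by (cases n) (auto simp: G0 coeff_G_Suc)

text \<open>Only \<open>A 0\<close> and \<open>A 1\<close> have a constant term, which leaves
  \<open>j = Suc n\<close> and \<open>j = n\<close>. For \<open>n = 0\<close> the latter is outside
  the range, whence \<open>f 0 = 0\<close>.\<close>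

lemma sum_mult_A_coeff_0:
  assumes "f 0 = 0"
  shows "(\<Sum>j=1..Suc n. f j * coeff (A (Suc n - j)) 0) = f (Suc n) + f n"
proof -
  have "(\<Sum>j=1..Suc n. f j * coeff (A (Suc n - j)) 0) = (\<Sum>j\<in>{n, Suc n}. f j)"
    using assms by (intro sum.mono_neutral_cong) (auto simp: A_coeff_0 not_less_eq_eq)
  then show ?thesis by simp
qed

lemma U_coeff_2_Suc_Suc: "coeff (U (Suc (Suc n))) 2 = coeff (H (Suc n)) 2 + coeff (H n) 2"
proof -
  have "coeff (U (Suc (Suc n))) 2 = (\<Sum>j=1..Suc n. coeff (H j) 2 * coeff (A (Suc n - j)) 0)"
    unfolding coeff_U_Suc using H_coeff_1
    by (intro sum.cong) (auto simp: numeral_2_eq_2 H_coeff_0)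
  then show ?thesis by (subst (asm) sum_mult_A_coeff_0) (simp_all add: H0)
qed

text \<open>\<open>G 1\<close> supplies the initial 1; from \<open>n = 2\<close> on
  \<open>G n\<close> has no x^2 term, so \<open>U_coeff_2_Suc_Suc\<close> is the Fibonacci
  recurrence.\<close>

lemma H_coeff_2: "coeff (H n) 2 = fib n"
proof (induction n rule: fib.induct)
  case 2
  show ?case by (simp add: HUG G_coeff_2 U_Suc)
next
  case (3 n)
  then show ?case by (simp add: HUG[of "Suc (Suc n)"] G_coeff_2 U_coeff_2_Suc_Suc)
qed (simp add: H0)

lemma A_coeff_2: "coeff (A n) 2 = (if n \<le> 1 then 0 else F n)"
proof -
  consider "n = 0" | "n = 1" | m where "n = Suc (Suc m)"
    by (metis One_nat_def not0_implies_Suc)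
  then show ?thesis
    by cases (simp_all add: A0 A_Suc H0 U_Suc[of 0] U_coeff_2_Suc_Suc H_coeff_2 F_def)
qed

text \<open>Degree 1 never occurs and \<open>H j\<close> has no constant term for
  \<open>j > 0\<close>, so degree 4 splits only as 4+0 or 2+2.\<close>

lemma U_coeff_4_Suc_Suc:
  "coeff (U (Suc (Suc n))) 4 = coeff (H (Suc n)) 4 + coeff (H n) 4 + (\<Sum>j=1..n - 1. fib j * F (Suc n - j))"
proof -
  have "coeff (U (Suc (Suc n))) 4 = (\<Sum>j=1..Suc n. coeff (H j) 4 * coeff (A (Suc n - j)) 0 +
      coeff (H j) 2 * coeff (A (Suc n - j)) 2)"
    unfolding coeff_U_Suc using H_coeff_1 A_coeff_1
    by (intro sum.cong) (auto simp: eval_nat_numeral H_coeff_0)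
  also have "\<dots> = coeff (H (Suc n)) 4 + coeff (H n) 4 +
      (\<Sum>j=1..Suc n. coeff (H j) 2 * coeff (A (Suc n - j)) 2)"
    unfolding sum.distrib by (subst sum_mult_A_coeff_0) (simp_all add: H0)
  \<comment> \<open>The last two terms vanish because \<open>A 1\<close> and \<open>A 0\<close> have
    no x^2 term.\<close>
  also have "(\<Sum>j=1..Suc n. coeff (H j) 2 * coeff (A (Suc n - j)) 2) = (\<Sum>j=1..n - 1. fib j * F (Suc n - j))"
    by (intro sum.mono_neutral_cong_right) (auto simp: H_coeff_2 A_coeff_2)
  finally show ?thesis .
qed

text \<open>From \<open>n = 3\<close> on only \<open>U n\<close> contributes; at
  \<open>n = 2\<close> the x^3 term of \<open>G 2\<close> would add 1.\<close>

lemma G_coeff_4: "n \<ge> 3 \<Longrightarrow> coeff (G (Suc n)) 4 = fib n"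
  using H_coeff_2[of n] G_coeff_3 by (simp add: coeff_G_Suc HUG G_coeff_2)

lemma A_coeff_4:
  "coeff (A (Suc (Suc n))) 4 =
     2 * coeff (H (Suc n)) 4 + coeff (H n) 4 + (\<Sum>i=2..n. F (i - 2) * F (Suc (Suc n) - i))"
proof -
  have "(\<Sum>j=1..n - 1. fib j * F (Suc n - j)) = (\<Sum>i=2..n. F (i - 2) * F (Suc (Suc n) - i))"
    by (rule sum.reindex_bij_witness[of _ "\<lambda>i. i - 1" Suc]) (auto simp: F_def Suc_diff_Suc)
  then show ?thesis by (simp add: A_Suc U_coeff_4_Suc_Suc)
qed

lemma H_coeff_4:
  assumes "n \<ge> 3"
  shows "coeff (H (Suc (Suc n))) 4 = coeff (H (Suc n)) 4 + coeff (H n) 4 + F (Suc (Suc n)) +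
    (\<Sum>i=4..n. F (i - 2) * F (Suc (Suc n) - i))"
proof -
  \<comment> \<open>The terms \<open>j = 1, 2\<close> give
    \<open>F n + F (n - 1) = fib (n + 2)\<close>, which together with \<open>fib (n + 1)\<close>
    from \<open>G_coeff_4\<close> makes \<open>F (n + 2)\<close>.\<close>
  have "{1..n - 1} = {1, 2} \<union> {3..n - 1}" using assms by auto
  then have "(\<Sum>j=1..n - 1. fib j * F (Suc n - j)) = F n + F (n - 1) + (\<Sum>j=3..n - 1. fib j * F (Suc n - j))"
    using assms by (simp add: eval_nat_numeral)
  also have "(\<Sum>j=3..n - 1. fib j * F (Suc n - j)) = (\<Sum>i=4..n. F (i - 2) * F (Suc (Suc n) - i))"
    by (rule sum.reindex_bij_witness[of _ "\<lambda>i. i - 1" Suc]) (auto simp: F_def Suc_diff_Suc)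
  also have "F n + F (n - 1) = fib (Suc (Suc n))"
    using assms by (simp add: F_def)
  finally show ?thesis
    using assms by (simp add: HUG[of "Suc (Suc n)"] U_coeff_4_Suc_Suc G_coeff_4 F_def)
qed

end

section \<open>Vanishing by degree for short permutations, and the final assembly\<close>

lemma coeff_sum_monom_box_eq_0:
  assumes "n < k"
  shows "coeff (\<Sum>\<sigma>\<in>S. monom (1::nat) (box n \<sigma>)) k = 0"
proof -
  have "box n \<sigma> \<le> n" for \<sigma>
    unfolding box_def using card_mono[of "{1..n}"] by (metis (no_types, lifting) card_atLeastAtMost
      diff_Suc_1 finite_atLeastAtMost mem_Collect_eq subsetI)
  then have "box n \<sigma> \<noteq> k" for \<sigma> using assms by (metis leD)
  then show ?thesis by (simp add: coeff_sum)
qed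

theorem theorem5:
  shows "(\<forall>n::nat. n \<le> 3 \<longrightarrow>
            coeff (A_poly n) 4 = 0 \<and> coeff (B_poly n) 4 = 0 \<and> coeff (E_poly n) 4 = 0) \<and>
         coeff (B_poly 4) 4 = 2 \<and>
         coeff (B_poly 5) 4 = 6 \<and>
         (\<forall>n::nat. n \<ge> 4 \<longrightarrow>
            coeff (A_poly n) 4 =
              2 * coeff (B_poly n) 4 + coeff (B_poly (n - 1)) 4
              + (\<Sum>i = 2..n - 2. F (i - 2) * F (n - i))) \<and>
         (\<forall>n::nat. n \<ge> 6 \<longrightarrow>
            coeff (B_poly n) 4 =
              coeff (B_poly (n - 1)) 4 + coeff (B_poly (n - 2)) 4 + F (n - 1)
              + (\<Sum>i = 4..n - 3. F (i - 2) * F (n - 1 - i)))"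
proof -
  obtain U G where UG: "end_recurrence A_poly (\<lambda>n. B_poly (Suc n)) U G"
    using end_recurrence_avoiders by (auto simp: A_poly_eq_gf[abs_def] B_poly_Suc_eq_gf)
  have A_sum: "A_poly (Suc n) = B_poly (Suc n) + (\<Sum>j=1..n. B_poly (Suc j) * A_poly (n - j))" for n
    using gf_avoiders_Suc[of n] by (simp add: A_poly_eq_gf B_poly_Suc_eq_gf)
  interpret box_recurrence A_poly "\<lambda>n. B_poly (Suc n)" U G
  proof
    fix n
    have *: "U (Suc n) + B_poly (Suc n) = A_poly (Suc n)"
      using UG unfolding end_recurrence_def by blast
    then show "A_poly (Suc n) = B_poly (Suc n) + U (Suc n)"
      by (simp add: add.commute)
    then show "U (Suc n) = (\<Sum>j=1..n. B_poly (Suc j) * A_poly (n - j))"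
      using A_sum[of n] by simp
  qed (use UG in \<open>auto simp: end_recurrence_def A_poly_0\<close>)
  have small: "coeff (A_poly n) 4 = 0 \<and> coeff (B_poly n) 4 = 0 \<and> coeff (E_poly n) 4 = 0"
    if "n \<le> 3" for n
    using that unfolding A_poly_def B_poly_def E_poly_def
    by (intro conjI coeff_sum_monom_box_eq_0) simp_all
  have A: "coeff (A_poly n) 4 = 2 * coeff (B_poly n) 4 + coeff (B_poly (n - 1)) 4
      + (\<Sum>i = 2..n - 2. F (i - 2) * F (n - i))" if "n \<ge> 4" for n
  proof -
    have "Suc (Suc (n - 2)) = n" "Suc (n - 2) = n - 1" "Suc (n - 1) = n"
      using that by auto
    then show ?thesis using A_coeff_4[of "n - 2"] by simp
  qed
  have B: "coeff (B_poly n) 4 = coeff (B_poly (n - 1)) 4 + coeff (B_poly (n - 2)) 4 + F (n - 1)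
      + (\<Sum>i = 4..n - 3. F (i - 2) * F (n - 1 - i))" if "n \<ge> 6" for n
  proof -
    have "n - 3 \<ge> 3" "Suc (Suc (n - 3)) = n - 1" "Suc (n - 3) = n - 2"
      "Suc (n - 1) = n" "Suc (n - 2) = n - 1"
      using that by auto
    then show ?thesis using H_coeff_4[of "n - 3"] by simp
  qed
  have G4: "coeff (G 3) 4 = 2"
    using H_coeff_2[of 2] G_coeff_3[of 2] G_coeff_2[of 2] HUG[of 2]
    by (simp add: eval_nat_numeral coeff_G_Suc)
  \<comment> \<open>\<open>A_poly 3\<close> has no x^4 term, hence neither has its summand
    \<open>U 3\<close>; only \<open>G 3\<close> contributes.\<close>
  have B4: "coeff (B_poly 4) 4 = 2"
    using HUG[of 3] G4 A_Suc[of 2] small[of 3] by (simp add: eval_nat_numeral)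
  \<comment> \<open>Removing the 2 of \<open>B_poly 4\<close> from this 6 leaves 4 for
    \<open>U 4\<close>; \<open>G 4\<close> adds \<open>fib 3 = 2\<close>.\<close>
  have "coeff (A_poly 4) 4 = 6"
    using A[of 4] B4 small[of 3] by (simp add: F_def eval_nat_numeral)
  then have "coeff (B_poly 5) 4 = 6"
    using HUG[of 4] A_Suc[of 3] G_coeff_4[of 3] B4 by (simp add: eval_nat_numeral)
  with small A B B4 show ?thesis by blast
qed

end
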